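(* Let $(\mathfrak g,\mathfrak h,\phi)$ be a pre-Lie-morphism triple and let $(\mathfrak g_t,\mathfrak h_t,\phi_t)$ be an infinitesimal deformation of $(\mathfrak g,\mathfrak h,\phi)$ generated by $(\omega,\varpi,\theta)$. Then $(\omega,\varpi,\theta)$ is closed, i.e. $\delta_{\rm preLie}(\omega,\varpi,\theta)=0$. Furthermore, if two infinitesimal deformations $(\mathfrak g_t,\mathfrak h_t,\phi_t)$ and $(\mathfrak g'_t,\mathfrak h'_t,\phi'_t)$ of $(\mathfrak g,\mathfrak h,\phi)$, generated by $(\omega,\varpi,\theta)$ and $(\omega',\varpi',\theta')$ respectively, are equivalent, then $(\omega,\varpi,\theta)$ and $(\omega',\varpi',\theta')$ are in the same cohomology class in $H^1(\phi,\phi)$.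
   Context: All vector spaces are finite dimensional over an algebraically closed field $\mathbb K$ of characteristic $0$. A pre-Lie algebra is a vector space $\mathfrak g$ with a bilinear product $\cdot_{\mathfrak g}$ satisfying $(x\cdot_{\mathfrak g} y)\cdot_{\mathfrak g} z-x\cdot_{\mathfrak g}(y\cdot_{\mathfrak g} z)=(y\cdot_{\mathfrak g} x)\cdot_{\mathfrak g} z-y\cdot_{\mathfrak g}(x\cdot_{\mathfrak g} z)$; put $[x,y]_{\mathfrak g}=x\cdot_{\mathfrak g} y-y\cdot_{\mathfrak g} x$. A pre-Lie-morphism triple $(\mathfrak g,\mathfrak h,\phi)$ consists of pre-Lie algebras $(\mathfrak g,\cdot_{\mathfrak g})$, $(\mathfrak h,\cdot_{\mathfrak h})$ and a linear map $\phi:\mathfrak g\to\mathfrak h$ with $\phi(x\cdot_{\mathfrak g}y)=\phi(x)\cdot_{\mathfrak h}\phi(y)$. Cohomology. A representation $(\rho,\mu)$ of $\mathfrak g$ on $V$ is a pair of linear maps $\mathfrak g\to\mathfrak{gl}(V)$ with $\rho$ a representation of the Lie algebra $(\mathfrak g,[\cdot,\cdot]_{\mathfrak g})$ and $\rho(x)\mu(y)-\mu(y)\rho(x)=\mu(x\cdot_{\mathfrak g}y)-\mu(y)\mu(x)$. For $n\ge1$, $C^n_{\rm preLie}(\mathfrak g,V)=\mathrm{Hom}(\wedge^{n-1}\mathfrak g\otimes\mathfrak g,V)$ with coboundary $$\begin{aligned}\mathrm df(x_1,\dots,x_{n+1})=&\sum_{i=1}^n(-1)^{i+1}\rho(x_i)f(x_1,\dots,\hat{x_i},\dots,x_{n+1})+\sum_{i=1}^n(-1)^{i+1}\mu(x_{n+1})f(x_1,\dots,\hat{x_i},\dots,x_n,x_i)\\&-\sum_{i=1}^n(-1)^{i+1}f(x_1,\dots,\hat{x_i},\dots,x_n,x_i\cdot_{\mathfrak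 g}x_{n+1})\\&+\sum_{1\le i<j\le n}(-1)^{i+j}f([x_i,x_j]_{\mathfrak g},x_1,\dots,\hat{x_i},\dots,\hat{x_j},\dots,x_{n+1}).\end{aligned}$$ Let $\mathrm d_{\mathfrak g},\mathrm d_{\mathfrak h}$ be the coboundaries for the regular representations ($\rho(x)y=x\cdot y$, $\mu(x)y=y\cdot x$), and $\mathrm d_\phi$ the coboundary of $\mathfrak g$ for $(\mathfrak h;\rho_\phi,\mu_\phi)$, $\rho_\phi(x)u=\phi(x)\cdot_{\mathfrak h}u$, $\mu_\phi(x)u=u\cdot_{\mathfrak h}\phi(x)$. For $k\ge0$, $\mathcal C^k_{\rm preLie}(\phi,\phi)=C^{k+1}_{\rm preLie}(\mathfrak g,\mathfrak g)\oplus C^{k+1}_{\rm preLie}(\mathfrak h,\mathfrak h)\oplus C^{k}_{\rm preLie}(\mathfrak g,\mathfrak h)$ with $C^0_{\rm preLie}(\mathfrak g,\mathfrak h):=0$, and $$\delta_{\rm preLie}(f_1,f_2,f_3)=\big(\mathrm d_{\mathfrak g}f_1,\mathrm d_{\mathfrak h}f_2,\mathrm d_\phi f_3+(-1)^k(\phi\circ f_1-\phi^*\circ f_2)\big),$$ where $(\phi\circ f_1)(x_1,\dots,x_{k+1})=\phi(f_1(x_1,\dots,x_{k+1}))$ and $(\phi^*\circ f_2)(x_1,\dots,x_{k+1})=f_2(\phi(x_1),\dots,\phi(x_{k+1}))$. One has $\delta_{\rm preLie}^2=0$, and $H^k(\phi,\phi)$ denotes the $k$-th cohomology group. Deformations.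 Let $\omega\in\mathrm{Hom}(\otimes^2\mathfrak g,\mathfrak g)$, $\varpi\in\mathrm{Hom}(\otimes^2\mathfrak h,\mathfrak h)$, $\theta\in\mathrm{Hom}(\mathfrak g,\mathfrak h)$, and put $x\cdot_ty=x\cdot_{\mathfrak g}y+t\omega(x,y)$, $u\ast_tv=u\cdot_{\mathfrak h}v+t\varpi(u,v)$, $\phi_t(x)=\phi(x)+t\theta(x)$. If $\mathfrak g_t=(\mathfrak g,\cdot_t)$ and $\mathfrak h_t=(\mathfrak h,\ast_t)$ are pre-Lie algebras for all $t$ and $\phi_t:\mathfrak g_t\to\mathfrak h_t$ is a pre-Lie algebra homomorphism modulo $t^3$, then $(\omega,\varpi,\theta)$ is said to generate a ($1$-parameter) infinitesimal deformation $(\mathfrak g_t,\mathfrak h_t,\phi_t)$ of $(\mathfrak g,\mathfrak h,\phi)$. Two infinitesimal deformations $(\mathfrak g_t,\mathfrak h_t,\phi_t)$, $(\mathfrak g'_t,\mathfrak h'_t,\phi'_t)$ are equivalent if there are $N\in\mathfrak{gl}(\mathfrak g)$, $S\in\mathfrak{gl}(\mathfrak h)$ such that $\mathrm{Id}_{\mathfrak g}+tN:\mathfrak g_t\to\mathfrak g'_t$ and $\mathrm{Id}_{\mathfrak h}+tS:\mathfrak h_t\to\mathfrak h'_t$ are families of pre-Lie algebra isomorphisms and $\phi'_t\circ(\mathrm{Id}_{\mathfrak g}+tN)=(\mathrm{Id}_{\mathfrak h}+tS)\circ\phi_t$. Here $t$ is treated as a formal parameter: all these conditions are identities of polynomials in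 $t$, and $\mathrm{Id}+tN$, $\mathrm{Id}+tS$ are invertible over $\mathbb K[[t]]$. *)

theory Defs
  imports
    "HOL-Computational_Algebra.Polynomial"
    "HOL-Computational_Algebra.Formal_Power_Series"
    "HOL-Library.Function_Algebras"
    "HOL-Library.Product_Plus"
    "HOL-Algebra.Coset"
begin

section \<open>Pre-Lie algebras\<close>

definition bilinear_map ::
  "('r::comm_ring_1 \<Rightarrow> 'a::ab_group_add \<Rightarrow> 'a) \<Rightarrow> ('r \<Rightarrow> 'b::ab_group_add \<Rightarrow> 'b) \<Rightarrow>
   ('r \<Rightarrow> 'c::ab_group_add \<Rightarrow> 'c) \<Rightarrow> ('a \<Rightarrow> 'b \<Rightarrow> 'c) \<Rightarrow> bool" where
  "bilinear_map s1 s2 s3 B \<longleftrightarrow>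
     (\<forall>x. module_hom s2 s3 (\<lambda>y. B x y)) \<and> (\<forall>y. module_hom s1 s3 (\<lambda>x. B x y))"

text \<open>The scalars form a commutative ring, so that the same notion applies over the ground field
  and over formal power series in the deformation parameter.\<close>

locale pre_Lie_algebra = module scale
  for scale :: "'r::comm_ring_1 \<Rightarrow> 'g::ab_group_add \<Rightarrow> 'g" +
  fixes prod :: "'g \<Rightarrow> 'g \<Rightarrow> 'g" (infixl "\<cdot>" 70)
  assumes bilinear: "bilinear_map scale scale scale (\<cdot>)"
    and pre_Lie_identity: "(x \<cdot> y) \<cdot> z - x \<cdot> (y \<cdot> z) = (y \<cdot> x) \<cdot> z - y \<cdot> (x \<cdot> z)"

definition commutator :: "('g \<Rightarrow> 'g \<Rightarrow> 'g::ab_group_add) \<Rightarrow> 'g \<Rightarrow> 'g \<Rightarrow> 'g" where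
  "commutator p x y = p x y - p y x"

locale pre_Lie_morphism_triple =
  g: pre_Lie_algebra sg pg + h: pre_Lie_algebra sh ph + module_hom sg sh \<phi>
  for sg :: "'r::comm_ring_1 \<Rightarrow> 'g::ab_group_add \<Rightarrow> 'g" and pg
    and sh :: "'r \<Rightarrow> 'h::ab_group_add \<Rightarrow> 'h" and ph
    and \<phi> :: "'g \<Rightarrow> 'h" +
  assumes preserves_prod: "\<phi> (pg x y) = ph (\<phi> x) (\<phi> y)"

definition pre_Lie_isomorphism where
  "pre_Lie_isomorphism s p s' p' f \<longleftrightarrow> pre_Lie_morphism_triple s p s' p' f \<and> bij f"


section \<open>Cohomology\<close>

text \<open>An \<open>n\<close>-cochain is a function on argument lists that vanishes on lists of length other
  than \<open>n\<close>; on lists of length \<open>n\<close> it is linear in every entry and alternating in the first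
  \<open>n - 1\<close> entries. By convention the only cochain of degree 0 is zero.\<close>

definition cochains ::
  "('k::comm_ring_1 \<Rightarrow> 'g::ab_group_add \<Rightarrow> 'g) \<Rightarrow> ('k \<Rightarrow> 'v::ab_group_add \<Rightarrow> 'v) \<Rightarrow>
   nat \<Rightarrow> ('g list \<Rightarrow> 'v) set" where
  "cochains sg sv n = (if n = 0 then {0} else
     {f. (\<forall>xs. length xs \<noteq> n \<longrightarrow> f xs = 0)
       \<and> (\<forall>xs i. length xs = n \<longrightarrow> i < n \<longrightarrow> module_hom sg sv (\<lambda>x. f (xs[i := x])))
       \<and> (\<forall>xs i j. length xs = n \<longrightarrow> i < j \<longrightarrow> j < n - 1 \<longrightarrow> xs ! i = xs ! j \<longrightarrow> f xs = 0)})"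

text \<open>The coboundary on \<open>n\<close>-cochains for a representation \<open>(\<rho>, \<mu>)\<close>. Positions count from 0,
  so \<open>x\<^sub>i\<close> is \<open>xs ! (i - 1)\<close> and the distinguished last argument is \<open>xs ! n\<close>;
  \<open>nths xs (- A)\<close> omits the arguments at the positions in \<open>A\<close>.
  The signs are unchanged by the shift: \<open>i + 1\<close> becomes \<open>i\<close>, and \<open>i + j\<close> keeps its parity.\<close>

definition coboundary ::
  "('g \<Rightarrow> 'g \<Rightarrow> 'g::ab_group_add) \<Rightarrow> ('k::comm_ring_1 \<Rightarrow> 'v::ab_group_add \<Rightarrow> 'v) \<Rightarrow>
   ('g \<Rightarrow> 'v \<Rightarrow> 'v) \<Rightarrow> ('g \<Rightarrow> 'v \<Rightarrow> 'v) \<Rightarrow> nat \<Rightarrow> ('g list \<Rightarrow> 'v) \<Rightarrow> ('g list \<Rightarrow> 'v)" where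
  "coboundary pg sv \<rho> \<mu> n f = (\<lambda>xs. if length xs = n + 1 then
       (\<Sum>i<n. sv ((-1) ^ i) (\<rho> (xs ! i) (f (nths xs (- {i})))))
     + (\<Sum>i<n. sv ((-1) ^ i) (\<mu> (xs ! n) (f (nths xs (- {i, n}) @ [xs ! i]))))
     - (\<Sum>i<n. sv ((-1) ^ i) (f (nths xs (- {i, n}) @ [pg (xs ! i) (xs ! n)])))
     + (\<Sum>j<n. \<Sum>i<j. sv ((-1) ^ (i + j))
          (f (commutator pg (xs ! i) (xs ! j) # nths xs (- {i, j}))))
     else 0)"

definition d_regular where
  "d_regular sg pg = coboundary pg sg (\<lambda>x y. pg x y) (\<lambda>x y. pg y x)"

definition d_along where
  "d_along pg sh ph \<phi> = coboundary pg sh (\<lambda>x u. ph (\<phi> x) u) (\<lambda>x u. ph u (\<phi> x))"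

type_synonym ('g, 'h) triple_cochain = "('g list \<Rightarrow> 'g) \<times> ('h list \<Rightarrow> 'h) \<times> ('g list \<Rightarrow> 'h)"

definition triple_cochains ::
  "('k::comm_ring_1 \<Rightarrow> 'g::ab_group_add \<Rightarrow> 'g) \<Rightarrow> ('k \<Rightarrow> 'h::ab_group_add \<Rightarrow> 'h) \<Rightarrow>
   nat \<Rightarrow> ('g, 'h) triple_cochain set" where
  "triple_cochains sg sh k = cochains sg sg (k + 1) \<times> cochains sh sh (k + 1) \<times> cochains sg sh k"

definition triple_coboundary ::
  "('k::comm_ring_1 \<Rightarrow> 'g::ab_group_add \<Rightarrow> 'g) \<Rightarrow> ('g \<Rightarrow> 'g \<Rightarrow> 'g) \<Rightarrow>
   ('k \<Rightarrow> 'h::ab_group_add \<Rightarrow> 'h) \<Rightarrow> ('h \<Rightarrow> 'h \<Rightarrow> 'h) \<Rightarrow> ('g \<Rightarrow> 'h) \<Rightarrow>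
   nat \<Rightarrow> ('g, 'h) triple_cochain \<Rightarrow> ('g, 'h) triple_cochain" where
  "triple_coboundary sg pg sh ph \<phi> k = (\<lambda>(f1, f2, f3).
     (d_regular sg pg (k + 1) f1,
      d_regular sh ph (k + 1) f2,
      \<lambda>xs. d_along pg sh ph \<phi> k f3 xs + sh ((-1) ^ k) (\<phi> (f1 xs) - f2 (map \<phi> xs))))"

definition cocycle_group where
  "cocycle_group sg pg sh ph \<phi> k =
     \<lparr>carrier = {c \<in> triple_cochains sg sh k. triple_coboundary sg pg sh ph \<phi> k c = 0},
      monoid.mult = (+), one = 0\<rparr>"

definition coboundaries where
  "coboundaries sg pg sh ph \<phi> k =
     (if k = 0 then {0} else triple_coboundary sg pg sh ph \<phi> (k - 1) ` triple_cochains sg sh (k - 1))"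

definition cohomology_group where
  "cohomology_group sg pg sh ph \<phi> k =
     cocycle_group sg pg sh ph \<phi> k Mod coboundaries sg pg sh ph \<phi> k"

definition cochain1 :: "('a \<Rightarrow> 'v::zero) \<Rightarrow> 'a list \<Rightarrow> 'v" where
  "cochain1 \<theta> xs = (case xs of [x] \<Rightarrow> \<theta> x | _ \<Rightarrow> 0)"

definition cochain2 :: "('a \<Rightarrow> 'a \<Rightarrow> 'v::zero) \<Rightarrow> 'a list \<Rightarrow> 'v" where
  "cochain2 \<omega> xs = (case xs of [x, y] \<Rightarrow> \<omega> x y | _ \<Rightarrow> 0)"

text \<open>A triple of multilinear maps as an element of the complex in degree 1.\<close>

definition triple_cochain_of where
  "triple_cochain_of \<omega> \<pi> \<theta> = (cochain2 \<omega>, cochain2 \<pi>, cochain1 \<theta>)"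


section \<open>Infinitesimal deformations\<close>

text \<open>The deformation parameter \<open>t\<close> is \<open>fps_X\<close>. For a finite dimensional space of type \<open>'g\<close>
  over \<open>'k\<close>, the module obtained by extending scalars to formal power series has type
  \<open>'g fps\<close>. Linear and bilinear maps extend coefficientwise; \<open>fps_bilin\<close> applied to the scalar
  multiplication of \<open>'g\<close> is the scalar multiplication of \<open>'k fps\<close> on \<open>'g fps\<close>.
  An identity between (bi)linear expressions that are polynomial in \<open>t\<close> holds on \<open>'g fps\<close>
  exactly when it holds coefficientwise in \<open>t\<close> on constant arguments.\<close>

definition fps_bilin :: "('a \<Rightarrow> 'b \<Rightarrow> 'c::comm_monoid_add) \<Rightarrow> 'a fps \<Rightarrow> 'b fps \<Rightarrow> 'c fps" where
  "fps_bilin B x y = Abs_fps (\<lambda>n. \<Sum>i=0..n. B (fps_nth x i) (fps_nth y (n - i)))"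

definition fps_lin :: "('a \<Rightarrow> 'b) \<Rightarrow> 'a fps \<Rightarrow> 'b fps" where
  "fps_lin f x = Abs_fps (\<lambda>n. f (fps_nth x n))"

definition deformed_prod ::
  "('k::comm_ring_1 \<Rightarrow> 'g::ab_group_add \<Rightarrow> 'g) \<Rightarrow> ('g \<Rightarrow> 'g \<Rightarrow> 'g) \<Rightarrow> ('g \<Rightarrow> 'g \<Rightarrow> 'g) \<Rightarrow>
   'g fps \<Rightarrow> 'g fps \<Rightarrow> 'g fps" where
  "deformed_prod s p \<omega> x y = fps_bilin p x y + fps_bilin s fps_X (fps_bilin \<omega> x y)"

definition deformed_map ::
  "('k::comm_ring_1 \<Rightarrow> 'h::ab_group_add \<Rightarrow> 'h) \<Rightarrow> ('g \<Rightarrow> 'h) \<Rightarrow> ('g \<Rightarrow> 'h) \<Rightarrow>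
   'g fps \<Rightarrow> 'h fps" where
  "deformed_map s \<phi> \<theta> x = fps_lin \<phi> x + fps_bilin s fps_X (fps_lin \<theta> x)"

definition generates_infinitesimal_deformation where
  "generates_infinitesimal_deformation sg pg sh ph \<phi> \<omega> \<pi> \<theta> \<longleftrightarrow>
     bilinear_map sg sg sg \<omega> \<and> bilinear_map sh sh sh \<pi> \<and> module_hom sg sh \<theta> \<and>
     pre_Lie_algebra (fps_bilin sg) (deformed_prod sg pg \<omega>) \<and>
     pre_Lie_algebra (fps_bilin sh) (deformed_prod sh ph \<pi>) \<and>
     module_hom (fps_bilin sg) (fps_bilin sh) (deformed_map sh \<phi> \<theta>) \<and>
     (\<forall>x y. fps_cutoff 3 (deformed_map sh \<phi> \<theta> (deformed_prod sg pg \<omega> x y)) =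
            fps_cutoff 3 (deformed_prod sh ph \<pi> (deformed_map sh \<phi> \<theta> x) (deformed_map sh \<phi> \<theta> y)))"

text \<open>\<open>deformed_map sg id N\<close> is \<open>Id + t N\<close>; it is invertible on \<open>'g fps\<close> for every linear \<open>N\<close>.\<close>

definition equivalent_deformations where
  "equivalent_deformations sg pg sh ph \<phi> \<omega> \<pi> \<theta> \<omega>' \<pi>' \<theta>' \<longleftrightarrow>
     (\<exists>N S. module_hom sg sg N \<and> module_hom sh sh S \<and>
        pre_Lie_isomorphism (fps_bilin sg) (deformed_prod sg pg \<omega>)
          (fps_bilin sg) (deformed_prod sg pg \<omega>') (deformed_map sg id N) \<and>
        pre_Lie_isomorphism (fps_bilin sh) (deformed_prod sh ph \<pi>)
          (fps_bilin sh) (deformed_prod sh ph \<pi>') (deformed_map sh id S) \<and>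
        deformed_map sh \<phi> \<theta>' \<circ> deformed_map sg id N = deformed_map sh id S \<circ> deformed_map sh \<phi> \<theta>)"

end

theory Submission
  imports Defs
begin

text \<open>
  The proof reads off the coefficient of \<open>t\<close> in each defining identity, on arguments constant in
  \<open>t\<close>. For the deformed products, the coefficient of \<open>t\<close> in the pre-Lie identity says that \<open>\<omega>\<close> is a
  2-cocycle of \<open>g\<close> and \<open>\<pi>\<close> one of \<open>h\<close>; for the homomorphism condition, where truncation at
  \<open>t\<^sup>3\<close> keeps this coefficient, it says that the third component of the coboundary of
  \<open>(\<omega>, \<pi>, \<theta>)\<close> vanishes. For an equivalence \<open>(Id + t N, Id + t S)\<close>, the coefficient of \<open>t\<close> says that
  \<open>\<omega> - \<omega>'\<close>, \<open>\<pi> - \<pi>'\<close> and \<open>\<theta> - \<theta>'\<close> are \<open>d N\<close>, \<open>d S\<close> and \<open>\<phi> \<circ> N - S \<circ> \<phi>\<close>, that is, the two triples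
  differ by the coboundary of \<open>(N, S, 0)\<close>.

  On the side of the complex it remains to write the coboundary in its lowest degrees as explicit
  formulas in \<open>\<omega>\<close>, \<open>\<theta>\<close>, \<open>N\<close> and \<open>S\<close>; lemmas \<open>coboundary_cochain1\<close>,
  \<open>coboundary_cochain2_eq_0_iff\<close> and \<open>triple_coboundary_0\<close> do this. The two triples then lie in
  the same coset of the subgroup of coboundaries.
\<close>

section \<open>Cochains and coboundaries in low degrees\<close>

lemma length_eq_2_conv: "length xs = 2 \<longleftrightarrow> (\<exists>x y. xs = [x, y])"
  by (auto simp: length_Suc_conv numeral_eq_Suc)

lemma length_eq_3_conv: "length xs = 3 \<longleftrightarrow> (\<exists>x y z. xs = [x, y, z])"
  by (auto simp: length_Suc_conv numeral_eq_Suc)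

lemma cochain1_eval [simp]: "cochain1 f [x] = f x"
  by (simp add: cochain1_def)

lemma cochain2_eval [simp]: "cochain2 f [x, y] = f x y"
  by (simp add: cochain2_def)

lemma cochain1_eq_0: "length xs \<noteq> 1 \<Longrightarrow> cochain1 f xs = 0"
  by (auto simp: cochain1_def split: list.split)

lemma cochain2_eq_0: "length xs \<noteq> 2 \<Longrightarrow> cochain2 f xs = 0"
  by (auto simp: cochain2_def split: list.split)

lemma cochain1_in_cochains:
  assumes "module_hom sg sv f"
  shows "cochain1 f \<in> cochains sg sv 1"
  using assms by (auto simp: cochains_def length_Suc_conv cochain1_eq_0)

lemma cochain2_in_cochains:
  assumes "bilinear_map sg sg sv f"
  shows "cochain2 f \<in> cochains sg sv 2"
  using assms
  by (auto simp: cochains_def length_eq_2_conv cochain2_eq_0 bilinear_map_def less_2_cases_iff)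

lemma zero_in_cochains:
  assumes "module sg" and "module sv"
  shows "0 \<in> cochains sg sv n"
  using module_pair.module_hom_zero[OF module_pair.intro[OF assms]] by (simp add: cochains_def)

lemma coboundary_cochain1:
  assumes "module sv"
  shows "coboundary pg sv \<rho> \<mu> 1 (cochain1 f) =
    cochain2 (\<lambda>x y. \<rho> x (f y) + \<mu> y (f x) - f (pg x y))"
proof
  fix xs
  show "coboundary pg sv \<rho> \<mu> 1 (cochain1 f) xs =
    cochain2 (\<lambda>x y. \<rho> x (f y) + \<mu> y (f x) - f (pg x y)) xs"
  proof (cases "length xs = 2")
    case True
    then obtain x y where "xs = [x, y]" by (auto simp: length_eq_2_conv)
    then show ?thesis
      using module.scale_one[OF assms] by (simp add: coboundary_def nths_Cons)
  qed (simp add: coboundary_def cochain2_eq_0)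
qed

text \<open>For the regular representation and bilinear \<open>f\<close>, the right-hand side is the coefficient of
  \<open>t\<close> in the pre-Lie identity of the product \<open>pg + t f\<close>, with the commutator term
  collecting \<open>f (pg x y) z\<close> and \<open>f (pg y x) z\<close>.\<close>

lemma coboundary_cochain2_eq_0_iff:
  assumes "module sv"
  shows "coboundary pg sv \<rho> \<mu> 2 (cochain2 f) = 0 \<longleftrightarrow>
    (\<forall>x y z. \<rho> x (f y z) - \<rho> y (f x z) + (\<mu> z (f y x) - \<mu> z (f x y))
       - (f y (pg x z) - f x (pg y z)) - f (commutator pg x y) z = 0)"
    (is "?d = 0 \<longleftrightarrow> (\<forall>x y z. ?D x y z = 0)")
proof -
  interpret module sv by fact
  have "?d [x, y, z] = ?D x y z" for x y z
    by (simp add: coboundary_def nths_Cons numeral_2_eq_2 lessThan_Suc)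
  moreover have "?d xs = 0" if "length xs \<noteq> 3" for xs
    using that by (simp add: coboundary_def)
  ultimately show ?thesis
    by (metis (no_types, opaque_lifting) ext length_eq_3_conv zero_fun_apply)
qed

lemma triple_cochain_of_add:
  "triple_cochain_of (\<lambda>x y. \<omega> x y + \<omega>' x y) (\<lambda>u v. \<pi> u v + \<pi>' u v) (\<lambda>x. \<theta> x + \<theta>' x) =
    triple_cochain_of \<omega> \<pi> \<theta> + triple_cochain_of \<omega>' \<pi>' \<theta>'"
  for \<omega> \<omega>' :: "'g::ab_group_add \<Rightarrow> 'g \<Rightarrow> 'g" and \<pi> \<pi>' :: "'h::ab_group_add \<Rightarrow> 'h \<Rightarrow> 'h"
    and \<theta> \<theta>' :: "'g \<Rightarrow> 'h"
  by (auto simp: triple_cochain_of_def cochain1_def cochain2_def fun_eq_iff split: list.split)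

context pre_Lie_morphism_triple
begin

lemma triple_coboundary_0:
  "triple_coboundary sg pg sh ph \<phi> 0 (cochain1 N, cochain1 S, 0) =
    triple_cochain_of (\<lambda>x y. pg x (N y) + pg (N x) y - N (pg x y))
      (\<lambda>u v. ph u (S v) + ph (S u) v - S (ph u v)) (\<lambda>x. \<phi> (N x) - S (\<phi> x))"
proof -
  have "d_along pg sh ph \<phi> 0 0 xs + sh ((-1) ^ 0) (\<phi> (cochain1 N xs) - cochain1 S (map \<phi> xs)) =
      cochain1 (\<lambda>x. \<phi> (N x) - S (\<phi> x)) xs" for xs
  proof (cases "length xs = 1")
    case True
    then show ?thesis by (auto simp: length_Suc_conv d_along_def coboundary_def)
  qed (simp add: d_along_def coboundary_def cochain1_eq_0 zero)
  then show ?thesis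
    by (simp add: triple_coboundary_def triple_cochain_of_def d_regular_def
        coboundary_cochain1[OF g.module_axioms, simplified]
        coboundary_cochain1[OF h.module_axioms, simplified])
qed

text \<open>The last conjunct is the coefficient of \<open>t\<close> in the condition that \<open>\<phi> + t \<theta>\<close> maps the
  product \<open>pg + t \<omega>\<close> to \<open>ph + t \<pi>\<close>; the sign \<open>(-1)\<^sup>1\<close> in the coboundary moves \<open>\<phi> \<circ> \<omega>\<close> to the
  side of \<open>\<theta>\<close>.\<close>

lemma triple_coboundary_1_eq_0_iff:
  "triple_coboundary sg pg sh ph \<phi> 1 (triple_cochain_of \<omega> \<pi> \<theta>) = 0 \<longleftrightarrow>
    d_regular sg pg 2 (cochain2 \<omega>) = 0 \<and> d_regular sh ph 2 (cochain2 \<pi>) = 0 \<and>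
    (\<forall>x y. \<phi> (\<omega> x y) + \<theta> (pg x y) = ph (\<phi> x) (\<theta> y) + ph (\<theta> x) (\<phi> y) + \<pi> (\<phi> x) (\<phi> y))"
proof -
  let ?third = "\<lambda>xs. d_along pg sh ph \<phi> 1 (cochain1 \<theta>) xs
    + sh ((-1) ^ 1) (\<phi> (cochain2 \<omega> xs) - cochain2 \<pi> (map \<phi> xs))"
  have "?third [x, y] = 0 \<longleftrightarrow>
      \<phi> (\<omega> x y) + \<theta> (pg x y) = ph (\<phi> x) (\<theta> y) + ph (\<theta> x) (\<phi> y) + \<pi> (\<phi> x) (\<phi> y)" for x y
    unfolding d_along_def coboundary_cochain1[OF h.module_axioms]
    by (simp add: algebra_simps) (metis add.commute add.left_commute)
  moreover have "?third xs = 0" if "length xs \<noteq> 2" for xs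
    unfolding d_along_def coboundary_cochain1[OF h.module_axioms]
    using that by (simp add: cochain2_eq_0 zero)
  ultimately have "?third = 0 \<longleftrightarrow> (\<forall>x y. \<phi> (\<omega> x y) + \<theta> (pg x y) =
      ph (\<phi> x) (\<theta> y) + ph (\<theta> x) (\<phi> y) + \<pi> (\<phi> x) (\<phi> y))"
    by (metis (no_types, lifting) ext length_eq_2_conv zero_fun_apply)
  then show ?thesis
    by (simp add: triple_coboundary_def triple_cochain_of_def zero_prod_def numeral_2_eq_2)
qed

text \<open>The hypotheses say that the two triples differ by the coboundary of \<open>(N, S, 0)\<close>, so the coset
  of the primed triple contains both; it contains the primed triple itself because zero is
  the coboundary of the zero triple.\<close>

lemma same_cohomology_class:
  assumes cocycle: "triple_cochain_of \<omega>' \<pi>' \<theta>' \<in> triple_cochains sg sh 1"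
      "triple_coboundary sg pg sh ph \<phi> 1 (triple_cochain_of \<omega>' \<pi>' \<theta>') = 0"
    and "module_hom sg sg N" and "module_hom sh sh S"
    and "\<And>x y. \<omega> x y = pg x (N y) + pg (N x) y - N (pg x y) + \<omega>' x y"
    and "\<And>u v. \<pi> u v = ph u (S v) + ph (S u) v - S (ph u v) + \<pi>' u v"
    and "\<And>x. \<theta> x = \<phi> (N x) - S (\<phi> x) + \<theta>' x"
  shows "\<exists>c \<in> carrier (cohomology_group sg pg sh ph \<phi> 1).
    triple_cochain_of \<omega> \<pi> \<theta> \<in> c \<and> triple_cochain_of \<omega>' \<pi>' \<theta>' \<in> c"
proof -
  let ?Z = "cocycle_group sg pg sh ph \<phi> 1" and ?B = "coboundaries sg pg sh ph \<phi> 1"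
  let ?c = "triple_cochain_of \<omega> \<pi> \<theta>" and ?c' = "triple_cochain_of \<omega>' \<pi>' \<theta>'"
  have B: "triple_coboundary sg pg sh ph \<phi> 0 (cochain1 N, cochain1 S, 0) \<in> ?B"
    if "module_hom sg sg N" "module_hom sh sh S" for N S
    using that zero_in_cochains[OF g.module_axioms h.module_axioms]
    by (auto simp: coboundaries_def triple_cochains_def cochain1_in_cochains
        simp flip: One_nat_def intro!: imageI)
  have "\<omega> = (\<lambda>x y. pg x (N y) + pg (N x) y - N (pg x y) + \<omega>' x y)"
    "\<pi> = (\<lambda>u v. ph u (S v) + ph (S u) v - S (ph u v) + \<pi>' u v)"
    "\<theta> = (\<lambda>x. \<phi> (N x) - S (\<phi> x) + \<theta>' x)"
    by (simp_all add: fun_eq_iff assms(5-7))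
  then have "?c = triple_coboundary sg pg sh ph \<phi> 0 (cochain1 N, cochain1 S, 0) + ?c'"
    by (simp only: triple_coboundary_0 triple_cochain_of_add)
  then have "?c \<in> ?B #>\<^bsub>?Z\<^esub> ?c'"
    using B \<open>module_hom sg sg N\<close> \<open>module_hom sh sh S\<close> by (auto simp: r_coset_def cocycle_group_def)
  moreover have "?c' \<in> ?B #>\<^bsub>?Z\<^esub> ?c'"
  proof -
    have "bilinear_map sg sg sg pg" "bilinear_map sh sh sh ph"
      by (fact g.bilinear h.bilinear)+
    then have "pg x 0 = 0" "pg 0 x = 0" "ph u 0 = 0" "ph 0 u = 0" for x u
      by (auto simp: bilinear_map_def dest: module_hom.zero)
    then have "triple_coboundary sg pg sh ph \<phi> 0 (cochain1 (\<lambda>x. 0), cochain1 (\<lambda>u. 0), 0) = 0"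
      by (auto simp: triple_coboundary_0 triple_cochain_of_def cochain1_def cochain2_def
          zero_prod_def fun_eq_iff zero split: list.split)
    then have "0 \<in> ?B"
      using B[OF module_pair.module_hom_zero module_pair.module_hom_zero]
        g.module_axioms h.module_axioms by (simp add: module_pair_def)
    then show ?thesis
      by (force simp: r_coset_def cocycle_group_def)
  qed
  moreover have "?B #>\<^bsub>?Z\<^esub> ?c' \<in> carrier (cohomology_group sg pg sh ph \<phi> 1)"
    using cocycle by (auto simp: cohomology_group_def FactGroup_def RCOSETS_def cocycle_group_def
        simp del: split_paired_Ex)
  ultimately show ?thesis by blast
qed

end


section \<open>Coefficients of the deformed structures\<close>

text \<open>The arguments are arbitrary power series, because deformed operations get nested, as in the
  pre-Lie identity: the inner value then has a coefficient of \<open>t\<close> even on constant arguments.\<close>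

lemma fps_bilin_nth_0: "fps_nth (fps_bilin B x y) 0 = B (fps_nth x 0) (fps_nth y 0)"
  by (simp add: fps_bilin_def)

lemma fps_bilin_nth_1:
  "fps_nth (fps_bilin B x y) 1 = B (fps_nth x 0) (fps_nth y 1) + B (fps_nth x 1) (fps_nth y 0)"
  by (simp add: fps_bilin_def)

lemma fps_lin_nth: "fps_nth (fps_lin f x) n = f (fps_nth x n)"
  by (simp add: fps_lin_def)

lemma deformed_prod_nth_0:
  assumes "module s"
  shows "fps_nth (deformed_prod s p \<omega> x y) 0 = p (fps_nth x 0) (fps_nth y 0)"
  by (simp add: deformed_prod_def fps_bilin_nth_0 module.scale_zero_left[OF assms])

lemma deformed_prod_nth_1:
  assumes "module s"
  shows "fps_nth (deformed_prod s p \<omega> x y) 1 =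
    p (fps_nth x 0) (fps_nth y 1) + p (fps_nth x 1) (fps_nth y 0) + \<omega> (fps_nth x 0) (fps_nth y 0)"
  by (simp only: deformed_prod_def fps_bilin_nth_0 fps_bilin_nth_1 fps_add_nth fps_X_nth)
    (simp add: module.scale_zero_left[OF assms] module.scale_one[OF assms])

lemma deformed_map_nth_0:
  assumes "module s"
  shows "fps_nth (deformed_map s f f' x) 0 = f (fps_nth x 0)"
  by (simp add: deformed_map_def fps_bilin_nth_0 fps_lin_nth module.scale_zero_left[OF assms])

lemma deformed_map_nth_1:
  assumes "module s"
  shows "fps_nth (deformed_map s f f' x) 1 = f (fps_nth x 1) + f' (fps_nth x 0)"
  by (simp only: deformed_map_def fps_bilin_nth_0 fps_bilin_nth_1 fps_add_nth fps_X_nth fps_lin_nth)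
    (simp add: module.scale_zero_left[OF assms] module.scale_one[OF assms])

lemmas deformed_nth =
  deformed_prod_nth_0 deformed_prod_nth_1 deformed_map_nth_0 deformed_map_nth_1


section \<open>First-order consequences of the deformation equations\<close>

lemma deformed_prod_cocycle:
  assumes "pre_Lie_algebra s p" and "bilinear_map s s s \<omega>"
    and "pre_Lie_algebra (fps_bilin s) (deformed_prod s p \<omega>)"
  shows "d_regular s p 2 (cochain2 \<omega>) = 0"
proof -
  interpret pre_Lie_algebra s p by fact
  have p: "module_hom s s (p x)" "module_hom s s (\<lambda>y. p y x)" for x
    using bilinear by (auto simp: bilinear_map_def)
  have \<omega>: "\<omega> (x - y) z = \<omega> x z - \<omega> y z" for x y z
    using assms(2) by (simp add: bilinear_map_def module_hom.diff[of s s "\<lambda>x. \<omega> x z"])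
  have first_order: "p (\<omega> x y) z + \<omega> (p x y) z - (p x (\<omega> y z) + \<omega> x (p y z)) =
    p (\<omega> y x) z + \<omega> (p y x) z - (p y (\<omega> x z) + \<omega> y (p x z))" for x y z
    using arg_cong[OF pre_Lie_algebra.pre_Lie_identity[OF assms(3),
          of "fps_const x" "fps_const y" "fps_const z"], of "\<lambda>a. fps_nth a 1"]
    by (simp only: fps_sub_nth deformed_nth[OF module_axioms] fps_nth_fps_const)
      (simp add: module_hom.zero[OF p(1)] module_hom.zero[OF p(2)])
  have "p x (\<omega> y z) - p y (\<omega> x z) + (p (\<omega> y x) z - p (\<omega> x y) z)
      - (\<omega> y (p x z) - \<omega> x (p y z)) - \<omega> (commutator p x y) z = 0" for x y z
    using first_order[of x y z] by (simp add: commutator_def \<omega> algebra_simps)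
  then show ?thesis
    by (simp add: d_regular_def coboundary_cochain2_eq_0_iff[OF module_axioms])
qed

lemma deformation_cocycle:
  assumes "pre_Lie_morphism_triple sg pg sh ph \<phi>"
    and "generates_infinitesimal_deformation sg pg sh ph \<phi> \<omega> \<pi> \<theta>"
  shows "triple_coboundary sg pg sh ph \<phi> 1 (triple_cochain_of \<omega> \<pi> \<theta>) = 0"
proof -
  interpret pre_Lie_morphism_triple sg pg sh ph \<phi> by fact
  note d = assms(2)[unfolded generates_infinitesimal_deformation_def]
  have z: "pg x 0 = 0" "pg 0 x = 0" "ph u 0 = 0" "ph 0 u = 0" for x u
    using g.bilinear h.bilinear by (auto simp: bilinear_map_def dest: module_hom.zero)
  have "\<phi> (\<omega> x y) + \<theta> (pg x y) = ph (\<phi> x) (\<theta> y) + ph (\<theta> x) (\<phi> y) + \<pi> (\<phi> x) (\<phi> y)" for x y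
  proof -
    have "fps_cutoff 3 (deformed_map sh \<phi> \<theta> (deformed_prod sg pg \<omega> (fps_const x) (fps_const y))) =
      fps_cutoff 3 (deformed_prod sh ph \<pi> (deformed_map sh \<phi> \<theta> (fps_const x))
        (deformed_map sh \<phi> \<theta> (fps_const y)))"
      using d by blast
    \<comment> \<open>The coefficient of \<open>t\<close> lies below the cutoff, so the truncated equation still determines it.\<close>
    from arg_cong[OF this, of "\<lambda>a. fps_nth a 1"] show ?thesis
      by (simp only: fps_cutoff_nth deformed_nth[OF g.module_axioms]
          deformed_nth[OF h.module_axioms] fps_nth_fps_const) (simp add: z zero)
  qed
  then show ?thesis
    using d deformed_prod_cocycle[OF g.pre_Lie_algebra_axioms]
      deformed_prod_cocycle[OF h.pre_Lie_algebra_axioms]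
    unfolding triple_coboundary_1_eq_0_iff by blast
qed

text \<open>Comparing the coefficients of \<open>t\<close> in the multiplicativity of \<open>Id + t N\<close> shows that such an
  isomorphism changes the first-order term of the product by the coboundary \<open>d N\<close>.\<close>

lemma isomorphism_first_order:
  assumes "pre_Lie_algebra s p" and "module_hom s s N"
    and "pre_Lie_isomorphism (fps_bilin s) (deformed_prod s p \<omega>)
      (fps_bilin s) (deformed_prod s p \<omega>') (deformed_map s id N)"
  shows "\<omega> x y = p x (N y) + p (N x) y - N (p x y) + \<omega>' x y"
proof -
  interpret pre_Lie_algebra s p by fact
  have z: "p x 0 = 0" "p 0 x = 0" for x
    using bilinear by (auto simp: bilinear_map_def dest: module_hom.zero)
  have "deformed_map s id N (deformed_prod s p \<omega> (fps_const x) (fps_const y)) =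
    deformed_prod s p \<omega>' (deformed_map s id N (fps_const x)) (deformed_map s id N (fps_const y))"
    using assms(3) by (auto simp: pre_Lie_isomorphism_def
        dest: pre_Lie_morphism_triple.preserves_prod)
  from arg_cong[OF this, of "\<lambda>a. fps_nth a 1"]
  have "\<omega> x y + N (p x y) = p x (N y) + p (N x) y + \<omega>' x y"
    by (simp only: deformed_nth[OF module_axioms] fps_nth_fps_const) (simp add: z)
  then show ?thesis by (simp add: algebra_simps)
qed

lemma intertwining_first_order:
  assumes "module sg" and "module sh" and "\<phi> 0 = 0"
    and "deformed_map sh \<phi> \<theta>' \<circ> deformed_map sg id N = deformed_map sh id S \<circ> deformed_map sh \<phi> \<theta>"
  shows "\<theta> x = \<phi> (N x) - S (\<phi> x) + \<theta>' x"
proof -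
  have "deformed_map sh \<phi> \<theta>' (deformed_map sg id N (fps_const x)) =
    deformed_map sh id S (deformed_map sh \<phi> \<theta> (fps_const x))"
    using fun_cong[OF assms(4)] by simp
  from arg_cong[OF this, of "\<lambda>a. fps_nth a 1"]
  have "\<phi> (N x) + \<theta>' x = \<theta> x + S (\<phi> x)"
    by (simp only: deformed_nth[OF assms(1)] deformed_nth[OF assms(2)] fps_nth_fps_const)
      (simp add: assms(3))
  then show ?thesis by (simp add: algebra_simps)
qed


theorem theorem3p5:
  fixes sg :: "'k::{alg_closed_field, field_char_0} \<Rightarrow> 'g::ab_group_add \<Rightarrow> 'g"
    and sh :: "'k \<Rightarrow> 'h::ab_group_add \<Rightarrow> 'h"
    and pg :: "'g \<Rightarrow> 'g \<Rightarrow> 'g" and ph :: "'h \<Rightarrow> 'h \<Rightarrow> 'h" and \<phi> :: "'g \<Rightarrow> 'h"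
    and Bg :: "'g set" and Bh :: "'h set"
  assumes "finite_dimensional_vector_space sg Bg"
    and "finite_dimensional_vector_space sh Bh"
    and "pre_Lie_morphism_triple sg pg sh ph \<phi>"
  shows "(\<forall>\<omega> \<pi> \<theta>. generates_infinitesimal_deformation sg pg sh ph \<phi> \<omega> \<pi> \<theta> \<longrightarrow>
            triple_coboundary sg pg sh ph \<phi> 1 (triple_cochain_of \<omega> \<pi> \<theta>) = 0) \<and>
         (\<forall>\<omega> \<pi> \<theta> \<omega>' \<pi>' \<theta>'.
            generates_infinitesimal_deformation sg pg sh ph \<phi> \<omega> \<pi> \<theta> \<longrightarrow>
            generates_infinitesimal_deformation sg pg sh ph \<phi> \<omega>' \<pi>' \<theta>' \<longrightarrow>
            equivalent_deformations sg pg sh ph \<phi> \<omega> \<pi> \<theta> \<omega>' \<pi>' \<theta>' \<longrightarrow>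
            (\<exists>c \<in> carrier (cohomology_group sg pg sh ph \<phi> 1).
               triple_cochain_of \<omega> \<pi> \<theta> \<in> c \<and> triple_cochain_of \<omega>' \<pi>' \<theta>' \<in> c))"
proof (intro conjI allI impI)
  interpret pre_Lie_morphism_triple sg pg sh ph \<phi> by fact
  fix \<omega> \<pi> \<theta>
  assume d: "generates_infinitesimal_deformation sg pg sh ph \<phi> \<omega> \<pi> \<theta>"
  then show "triple_coboundary sg pg sh ph \<phi> 1 (triple_cochain_of \<omega> \<pi> \<theta>) = 0"
    by (rule deformation_cocycle[OF assms(3)])
  fix \<omega>' \<pi>' \<theta>'
  assume d': "generates_infinitesimal_deformation sg pg sh ph \<phi> \<omega>' \<pi>' \<theta>'"
    and "equivalent_deformations sg pg sh ph \<phi> \<omega> \<pi> \<theta> \<omega>' \<pi>' \<theta>'"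
  then obtain N S where NS: "module_hom sg sg N" "module_hom sh sh S"
    and iso: "pre_Lie_isomorphism (fps_bilin sg) (deformed_prod sg pg \<omega>)
          (fps_bilin sg) (deformed_prod sg pg \<omega>') (deformed_map sg id N)"
        "pre_Lie_isomorphism (fps_bilin sh) (deformed_prod sh ph \<pi>)
          (fps_bilin sh) (deformed_prod sh ph \<pi>') (deformed_map sh id S)"
    and comm: "deformed_map sh \<phi> \<theta>' \<circ> deformed_map sg id N =
          deformed_map sh id S \<circ> deformed_map sh \<phi> \<theta>"
    unfolding equivalent_deformations_def by blast
  have "triple_cochain_of \<omega>' \<pi>' \<theta>' \<in> triple_cochains sg sh 1"
    using d'
    by (simp add: triple_cochains_def triple_cochain_of_def
        generates_infinitesimal_deformation_def cochain1_in_cochains[simplified]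
        cochain2_in_cochains[simplified numeral_2_eq_2])
  then show "\<exists>c \<in> carrier (cohomology_group sg pg sh ph \<phi> 1).
      triple_cochain_of \<omega> \<pi> \<theta> \<in> c \<and> triple_cochain_of \<omega>' \<pi>' \<theta>' \<in> c"
    by (rule same_cohomology_class[OF _ deformation_cocycle[OF assms(3) d'] NS
          isomorphism_first_order[OF g.pre_Lie_algebra_axioms NS(1) iso(1)]
          isomorphism_first_order[OF h.pre_Lie_algebra_axioms NS(2) iso(2)]
          intertwining_first_order[OF g.module_axioms h.module_axioms zero comm]])
qed

end
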